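(* Let $X,X_1,X_2,\dots$ be i.i.d. random variables with $\mathbb{E}X^2<\infty$ and let $N(t)$, $t>0$, be a homogeneous Poisson process with rate $\lambda>0$, independent of the $X_j$. Put $N_\pi(t)=\prod_{j=1}^{N(t)}X_j$, $t>0$. Then for $0<s<t$, $$\mathrm{Cov}(N_\pi(t),N_\pi(s))=e^{\lambda t(\mathbb{E}X-1)}\left[e^{\lambda s\,\mathbb{E}[X(X-1)]}-e^{\lambda s(\mathbb{E}X-1)}\right]=e^{\lambda t(\mathbb{E}X-1)}\int_{s\mathbb{E}(X-1)}^{s\mathbb{E}X(X-1)}\lambda e^{\lambda w}\,\mathrm dw.$$
   Context: An empty product equals $1$. $\mathbb{E}X(X-1)$ means $\mathbb{E}[X(X-1)]$. *)

theory Defs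
  imports "HOL-Probability.Probability"
begin

context prob_space
begin

definition iid_sequence :: "(nat \<Rightarrow> 'a \<Rightarrow> real) \<Rightarrow> bool" where
  "iid_sequence X \<longleftrightarrow>
     indep_vars (\<lambda>_. borel) X UNIV \<and>
     (\<forall>j. distr M borel (X j) = distr M borel (X 0))"

text \<open>Increments are taken in \<^typ>\<open>nat\<close>; the truncation of the subtraction is harmless, since
  almost all paths are nondecreasing.\<close>

definition poisson_process :: "real \<Rightarrow> (real \<Rightarrow> 'a \<Rightarrow> nat) \<Rightarrow> bool" where
  "poisson_process rate N \<longleftrightarrow>
     (\<forall>t\<ge>0. random_variable (count_space UNIV) (N t)) \<and>
     (AE \<omega> in M. N 0 \<omega> = 0) \<and>
     (AE \<omega> in M. mono_on {0..} (\<lambda>t. N t \<omega>) \<and>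
        (\<forall>t\<ge>0. continuous (at_right t) (\<lambda>u. N u \<omega>))) \<and>
     (\<forall>n (\<tau> :: nat \<Rightarrow> real). 0 \<le> \<tau> 0 \<longrightarrow> (\<forall>i<n. \<tau> i < \<tau> (Suc i)) \<longrightarrow>
        indep_vars (\<lambda>_. count_space UNIV) (\<lambda>i \<omega>. N (\<tau> (Suc i)) \<omega> - N (\<tau> i) \<omega>) {..<n}) \<and>
     (\<forall>s t. 0 \<le> s \<longrightarrow> s < t \<longrightarrow>
        distr M (count_space UNIV) (\<lambda>\<omega>. N t \<omega> - N s \<omega>) =
        measure_pmf (poisson_pmf (rate * (t - s))))"

definition generated_events :: "'i set \<Rightarrow> 'b measure \<Rightarrow> ('i \<Rightarrow> 'a \<Rightarrow> 'b) \<Rightarrow> 'a set set" where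
  "generated_events I S Y =
     sigma_sets (space M) (\<Union>i\<in>I. {Y i -` A \<inter> space M | A. A \<in> sets S})"

definition covariance :: "('a \<Rightarrow> real) \<Rightarrow> ('a \<Rightarrow> real) \<Rightarrow> real" where
  "covariance Y Z = expectation (\<lambda>\<omega>. (Y \<omega> - expectation Y) * (Z \<omega> - expectation Z))"

end

definition poisson_product :: "(nat \<Rightarrow> 'a \<Rightarrow> real) \<Rightarrow> (real \<Rightarrow> 'a \<Rightarrow> nat) \<Rightarrow> real \<Rightarrow> 'a \<Rightarrow> real" where
  "poisson_product X N t \<omega> = (\<Prod>j = 1..N t \<omega>. X j \<omega>)"

end

theory Submission
  imports Defs
begin

text \<open>On the almost sure event \<open>N s \<le> N t\<close> all three variables \<open>N\<^sub>\<pi>(t)\<close>, \<open>N\<^sub>\<pi>(s)\<close> and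
  \<open>N\<^sub>\<pi>(t) N\<^sub>\<pi>(s)\<close> have the form \<open>\<Prod>j\<le>N s. f (X j)\<close> times \<open>\<Prod>N s<j\<le>N t. g (X j)\<close>, with
  \<open>f\<close> and \<open>g\<close> among the monomials of degree at most \<open>2\<close>. Conditionally on
  the counts \<open>a = N s\<close> and \<open>b = N t - N s\<close> the expectation is \<open>(E f(X))^a (E g(X))^b\<close>, by Fubini.
  The increments are independent Poisson variables, so averaging over them gives the product of
  two values of the Poisson generating function \<open>E c^K = exp (r (c - 1))\<close>. Integrability follows
  by running the same computation with \<open>\<bar>f\<bar>\<close> and \<open>\<bar>g\<bar>\<close>.\<close>

section \<open>The generating function of the Poisson law\<close>

lemma poisson_pgf:
  fixes r c :: real
  assumes r: "r > 0"
  shows "integrable (measure_pmf (poisson_pmf r)) (\<lambda>k. c ^ k)"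
    and "(LINT k|measure_pmf (poisson_pmf r). c ^ k) = exp (r * (c - 1))"
proof -
  \<comment> \<open>The weight absorbs \<open>c ^ k\<close>, which leaves \<open>exp (- r)\<close>
    times the exponential series at \<open>r * c\<close>. That series converges absolutely for every
    real \<open>c\<close>, so negative means are covered as well.\<close>
  have w: "pmf (poisson_pmf r) k *\<^sub>R c ^ k = exp (- r) * ((r * c) ^ k /\<^sub>R fact k)" for k
    using r by (simp add: power_mult_distrib divide_inverse mult_ac)
  have "summable (\<lambda>k. norm (exp (- r) * ((r * c) ^ k /\<^sub>R fact k)))"
    using summable_mult[OF summable_norm_exp[of "r * c"], of "exp (- r)"] by (simp add: abs_mult)
  then have i: "integrable (count_space UNIV) (\<lambda>k. exp (- r) * ((r * c) ^ k /\<^sub>R fact k))"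
    by (simp only: integrable_count_space_nat_iff)
  show "integrable (measure_pmf (poisson_pmf r)) (\<lambda>k. c ^ k)"
    unfolding measure_pmf_eq_density
    by (subst integrable_density) (auto simp only: w i intro!: pmf_nonneg, auto)
  have "(LINT k|measure_pmf (poisson_pmf r). c ^ k)
      = (LINT k|count_space UNIV. exp (- r) * ((r * c) ^ k /\<^sub>R fact k))"
    unfolding measure_pmf_eq_density
    by (subst integral_density) (auto simp only: w intro!: pmf_nonneg, auto)
  also have "\<dots> = exp (- r) * exp (r * c)"
    using integral_count_space_nat[OF i] suminf_mult[OF summable_exp_generic[of "r * c"], of "exp (- r)"]
    by (simp add: exp_def)
  also have "\<dots> = exp (r * (c - 1))"
    by (simp add: algebra_simps flip: exp_add)
  finally show "(LINT k|measure_pmf (poisson_pmf r). c ^ k) = exp (r * (c - 1))" .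
qed

context prob_space
begin

lemma expectation_power_poisson:
  fixes c :: real
  assumes [measurable]: "random_variable (count_space UNIV) K"
    and K: "distr M (count_space UNIV) K = measure_pmf (poisson_pmf r)" and r: "r > 0"
  shows "integrable M (\<lambda>\<omega>. c ^ K \<omega>)" and "expectation (\<lambda>\<omega>. c ^ K \<omega>) = exp (r * (c - 1))"
proof -
  show "integrable M (\<lambda>\<omega>. c ^ K \<omega>)"
    using poisson_pgf(1)[OF r, of c] unfolding K[symmetric]
    by (subst (asm) integrable_distr_eq) auto
  show "expectation (\<lambda>\<omega>. c ^ K \<omega>) = exp (r * (c - 1))"
    using poisson_pgf(2)[OF r, of c] unfolding K[symmetric]
    by (subst (asm) integral_distr) auto
qed

section \<open>Conditioning on the counts, and moments of i.i.d. products\<close>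

text \<open>Conditioning on \<open>Z\<close> without conditional expectations: \<open>PM\<close>
  turns the left side into an integral over a product measure, and Fubini integrates
  \<open>W\<close> out first. Assumption \<open>ni\<close> is the absolute integrability that Fubini
  asks for.\<close>

lemma indep_countable_mixture:
  fixes Z :: "'a \<Rightarrow> 'c :: countable" and S :: "'d measure" and h :: "'c \<Rightarrow> 'd \<Rightarrow> real"
  assumes [measurable]: "random_variable (count_space UNIV) Z" "random_variable S W"
    and PM: "distr M (count_space UNIV) Z \<Otimes>\<^sub>M distr M S W
      = distr M (count_space UNIV \<Otimes>\<^sub>M S) (\<lambda>\<omega>. (Z \<omega>, W \<omega>))"
    and hS: "\<And>c. h c \<in> borel_measurable S"
    and hi: "\<And>c. integrable M (\<lambda>\<omega>. h c (W \<omega>))"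
    and ni: "integrable M (\<lambda>\<omega>. expectation (\<lambda>\<omega>'. \<bar>h (Z \<omega>) (W \<omega>')\<bar>))"
  shows "integrable M (\<lambda>\<omega>. h (Z \<omega>) (W \<omega>))"
    and "expectation (\<lambda>\<omega>. h (Z \<omega>) (W \<omega>)) = expectation (\<lambda>\<omega>. expectation (\<lambda>\<omega>'. h (Z \<omega>) (W \<omega>')))"
proof -
  note [measurable] = hS
  let ?Z = "distr M (count_space UNIV) Z" and ?W = "distr M S W"
  interpret Z: prob_space ?Z by (rule prob_space_distr) simp
  interpret W: prob_space ?W by (rule prob_space_distr) simp
  interpret P: pair_sigma_finite ?Z ?W ..
  \<comment> \<open>Joint measurability follows from that of each section \<open>h c\<close>,
    because \<open>Z\<close> takes values in a countable type.\<close>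
  have hm[measurable]: "(\<lambda>p. h (fst p) (snd p)) \<in> borel_measurable (count_space UNIV \<Otimes>\<^sub>M S)"
    by (rule measurable_pair_measure_countable1) auto
  have hp: "(\<lambda>p. h (fst p) (snd p)) \<in> borel_measurable (?Z \<Otimes>\<^sub>M ?W)"
    by simp
  have I: "integrable (?Z \<Otimes>\<^sub>M ?W) (\<lambda>p. h (fst p) (snd p))"
  proof (rule P.Fubini_integrable[OF hp])
    show "integrable ?Z (\<lambda>x. LINT y|?W. norm (h (fst (x, y)) (snd (x, y))))"
      using ni by (simp add: integrable_distr_eq integral_distr)
    show "AE x in ?Z. integrable ?W (\<lambda>y. h (fst (x, y)) (snd (x, y)))"
      using hi by (simp add: integrable_distr_eq)
  qed
  then show "integrable M (\<lambda>\<omega>. h (Z \<omega>) (W \<omega>))"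
    unfolding PM by (subst (asm) integrable_distr_eq) auto
  show "expectation (\<lambda>\<omega>. h (Z \<omega>) (W \<omega>)) = expectation (\<lambda>\<omega>. expectation (\<lambda>\<omega>'. h (Z \<omega>) (W \<omega>')))"
    using P.integral_fst'[OF I] unfolding PM
    by (simp add: integral_distr)
qed

text \<open>The expectation of a product of independent factors splits, and by equality of laws each
  factor contributes the value for the generic \<open>X 0\<close>. This is the conditional moment
  given block lengths \<open>a\<close> and \<open>b\<close>.\<close>

lemma iid_expectation_prod:
  fixes X :: "nat \<Rightarrow> 'a \<Rightarrow> real" and f g :: "real \<Rightarrow> real"
  assumes iid: "iid_sequence X"
    and [measurable]: "f \<in> borel_measurable borel" "g \<in> borel_measurable borel"
    and fi: "integrable M (\<lambda>\<omega>. f (X 0 \<omega>))" and gi: "integrable M (\<lambda>\<omega>. g (X 0 \<omega>))"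
  shows "integrable M (\<lambda>\<omega>. (\<Prod>j=1..a. f (X j \<omega>)) * (\<Prod>j=a+1..a+b. g (X j \<omega>)))" (is ?I)
    and "expectation (\<lambda>\<omega>. (\<Prod>j=1..a. f (X j \<omega>)) * (\<Prod>j=a+1..a+b. g (X j \<omega>)))
      = expectation (\<lambda>\<omega>. f (X 0 \<omega>)) ^ a * expectation (\<lambda>\<omega>. g (X 0 \<omega>)) ^ b" (is ?E)
proof -
  have iv: "indep_vars (\<lambda>_. borel) X UNIV" and D: "\<And>j. distr M borel (X j) = distr M borel (X 0)"
    using iid unfolding iid_sequence_def by auto
  have [measurable]: "random_variable borel (X j)" for j
    using iv unfolding indep_vars_def by auto
  have same: "integrable M (\<lambda>\<omega>. k (X j \<omega>)) \<longleftrightarrow> integrable M (\<lambda>\<omega>. k (X 0 \<omega>))"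
    "expectation (\<lambda>\<omega>. k (X j \<omega>)) = expectation (\<lambda>\<omega>. k (X 0 \<omega>))"
    if [measurable]: "k \<in> borel_measurable borel" for k :: "real \<Rightarrow> real" and j
    using integrable_distr_eq[of "X j" M borel k] integrable_distr_eq[of "X 0" M borel k]
      integral_distr[of "X j" M borel k] integral_distr[of "X 0" M borel k] D[of j]
    by simp_all
  \<comment> \<open>Letting the function depend on the index merges the two blocks into one product
    over \<open>{1..a+b}\<close>, so independence is applied only once.\<close>
  define u where "u j = (if j \<le> a then f else g)" for j
  have [measurable]: "u j \<in> borel_measurable borel" for j
    by (simp add: u_def)
  have split: "(\<Prod>j=1..a+b. k j) = (\<Prod>j=1..a. k j) * (\<Prod>j=a+1..a+b. k j)" for k :: "nat \<Rightarrow> real"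
    by (rule prod.ub_add_nat) simp
  have form: "(\<Prod>j=1..a. f (X j \<omega>)) * (\<Prod>j=a+1..a+b. g (X j \<omega>)) = (\<Prod>j=1..a+b. u j (X j \<omega>))" for \<omega>
    unfolding split by (intro arg_cong2[where f="(*)"] prod.cong) (auto simp: u_def)
  have ivu: "indep_vars (\<lambda>_. borel) (\<lambda>j \<omega>. u j (X j \<omega>)) {1..a+b}"
    by (rule indep_vars_compose2[OF indep_vars_subset[OF iv]]) auto
  have ui: "integrable M (\<lambda>\<omega>. u j (X j \<omega>))" for j
    using fi gi same(1)[of f j] same(1)[of g j] by (simp add: u_def)
  have uE: "expectation (\<lambda>\<omega>. u j (X j \<omega>))
      = (if j \<le> a then expectation (\<lambda>\<omega>. f (X 0 \<omega>)) else expectation (\<lambda>\<omega>. g (X 0 \<omega>)))" for j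
    using same(2)[of f j] same(2)[of g j] by (simp add: u_def)
  show ?I
    unfolding form by (rule indep_vars_integrable[OF _ ivu ui]) simp
  have "expectation (\<lambda>\<omega>. \<Prod>j=1..a+b. u j (X j \<omega>)) = (\<Prod>j=1..a+b. expectation (\<lambda>\<omega>. u j (X j \<omega>)))"
    by (rule indep_vars_lebesgue_integral[OF _ ivu ui]) simp
  also have "\<dots> = expectation (\<lambda>\<omega>. f (X 0 \<omega>)) ^ a * expectation (\<lambda>\<omega>. g (X 0 \<omega>)) ^ b"
    unfolding split uE by simp
  finally show ?E
    unfolding form .
qed

section \<open>Joint laws from independent generated sigma-algebras\<close>

text \<open>The library's binary independence predicate for random variables forces both to have the
  same value type; independence is therefore expressed by the factorization of the joint law.\<close>

lemma distr_pair_of_generated: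
  assumes ind: "indep_set (generated_events I S Y) (generated_events J T V)"
    and Z: "Z \<in> measurable (sigma (space M) (\<Union>i\<in>I. {Y i -` A \<inter> space M | A. A \<in> sets S})) S'"
    and W: "W \<in> measurable (sigma (space M) (\<Union>i\<in>J. {V i -` A \<inter> space M | A. A \<in> sets T})) T'"
  shows "random_variable S' Z" and "random_variable T' W"
    and "distr M S' Z \<Otimes>\<^sub>M distr M T' W = distr M (S' \<Otimes>\<^sub>M T') (\<lambda>\<omega>. (Z \<omega>, W \<omega>))"
proof -
  have ev: "generated_events I S Y \<subseteq> events" "generated_events J T V \<subseteq> events"
    and prod: "\<And>A B. A \<in> generated_events I S Y \<Longrightarrow> B \<in> generated_events J T V \<Longrightarrow>
      prob (A \<inter> B) = prob A * prob B"
    using ind unfolding indep_sets2_eq by auto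
  have sp: "Z \<in> space M \<rightarrow> space S'" "W \<in> space M \<rightarrow> space T'"
    using measurable_space[OF Z] measurable_space[OF W] by (auto simp: space_measure_of_conv)
  have pre: "A \<in> sets S' \<Longrightarrow> Z -` A \<inter> space M \<in> generated_events I S Y"
    "B \<in> sets T' \<Longrightarrow> W -` B \<inter> space M \<in> generated_events J T V" for A B
    using measurable_sets[OF Z, of A] measurable_sets[OF W, of B] unfolding generated_events_def
    by (subst (asm) sets_measure_of; force simp: space_measure_of_conv)+
  show rv[measurable]: "random_variable S' Z" "random_variable T' W"
    using sp pre ev by (auto intro!: measurableI)
  interpret Z: prob_space "distr M S' Z" by (rule prob_space_distr) simp
  interpret W: prob_space "distr M T' W" by (rule prob_space_distr) simp
  show "distr M S' Z \<Otimes>\<^sub>M distr M T' W = distr M (S' \<Otimes>\<^sub>M T') (\<lambda>\<omega>. (Z \<omega>, W \<omega>))"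
  \<comment> \<open>Measurable rectangles determine the product measure, and on a rectangle the
    claim is independence of the two preimages.\<close>
  proof (rule pair_measure_eqI)
    fix A B assume "A \<in> sets (distr M S' Z)" "B \<in> sets (distr M T' W)"
    then have [measurable]: "A \<in> sets S'" "B \<in> sets T'"
      by auto
    have "emeasure (distr M (S' \<Otimes>\<^sub>M T') (\<lambda>\<omega>. (Z \<omega>, W \<omega>))) (A \<times> B)
        = emeasure M ((Z -` A \<inter> space M) \<inter> (W -` B \<inter> space M))"
      by (subst emeasure_distr) (auto intro!: arg_cong[where f="emeasure M"])
    also have "\<dots> = emeasure M (Z -` A \<inter> space M) * emeasure M (W -` B \<inter> space M)"
      using prod[OF pre] by (simp add: emeasure_eq_measure ennreal_mult')
    finally show "emeasure (distr M S' Z) A * emeasure (distr M T' W) B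
        = emeasure (distr M (S' \<Otimes>\<^sub>M T') (\<lambda>\<omega>. (Z \<omega>, W \<omega>))) (A \<times> B)"
      by (simp add: emeasure_distr)
  qed (auto intro: Z.sigma_finite_measure_axioms W.sigma_finite_measure_axioms)
qed

lemma measurable_generated:
  assumes "i \<in> I" "Y i \<in> space M \<rightarrow> space S"
  shows "Y i \<in> measurable (sigma (space M) (\<Union>i\<in>I. {Y i -` A \<inter> space M | A. A \<in> sets S})) S"
proof (rule measurableI)
  show "Y i x \<in> space S" if "x \<in> space (sigma (space M) (\<Union>i\<in>I. {Y i -` A \<inter> space M | A. A \<in> sets S}))" for x
    using assms(2) that by (auto simp: space_measure_of_conv)
  show "Y i -` A \<inter> space (sigma (space M) (\<Union>i\<in>I. {Y i -` A \<inter> space M | A. A \<in> sets S}))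
      \<in> sets (sigma (space M) (\<Union>i\<in>I. {Y i -` A \<inter> space M | A. A \<in> sets S}))" if "A \<in> sets S" for A
    using assms(1) that
    by (subst sets_measure_of) (auto simp: space_measure_of_conv intro!: sigma_sets.Basic)
qed

section \<open>The two increments and the master formula for random products\<close>

lemma poisson_process_two_increments:
  assumes P: "poisson_process rate N" and st: "0 < s" "s < t"
  shows "indep_var (count_space UNIV) (\<lambda>\<omega>. N s \<omega> - N 0 \<omega>) (count_space UNIV) (\<lambda>\<omega>. N t \<omega> - N s \<omega>)"
proof -
  \<comment> \<open>The partition is \<open>0 < s < t\<close>; with \<open>n = 2\<close> only the
    points with index at most \<open>2\<close> matter.\<close>
  define \<tau> where "\<tau> i = (if i = 0 then 0 else if i = 1 then s else t)" for i :: nat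
  have "\<forall>n (\<tau> :: nat \<Rightarrow> real). 0 \<le> \<tau> 0 \<longrightarrow> (\<forall>i<n. \<tau> i < \<tau> (Suc i)) \<longrightarrow>
      indep_vars (\<lambda>_. count_space UNIV) (\<lambda>i \<omega>. N (\<tau> (Suc i)) \<omega> - N (\<tau> i) \<omega>) {..<n}"
    using P unfolding poisson_process_def by blast
  moreover have "0 \<le> \<tau> 0" "\<forall>i<2. \<tau> i < \<tau> (Suc i)"
    using st by (auto simp: \<tau>_def less_2_cases_iff)
  ultimately have "indep_vars (\<lambda>_. count_space UNIV) (\<lambda>i \<omega>. N (\<tau> (Suc i)) \<omega> - N (\<tau> i) \<omega>) {..<2}"
    by blast
  \<comment> \<open>Restricting to two singleton index sets and then projecting turns the
    independent family into an independent pair.\<close>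
  from indep_var_restrict[OF this, of "{0}" "{1}"]
  have "indep_var (PiM {0} (\<lambda>_. count_space UNIV)) (\<lambda>\<omega>. \<lambda>i\<in>{0}. N (\<tau> (Suc i)) \<omega> - N (\<tau> i) \<omega>)
      (PiM {1} (\<lambda>_. count_space UNIV)) (\<lambda>\<omega>. \<lambda>i\<in>{1}. N (\<tau> (Suc i)) \<omega> - N (\<tau> i) \<omega>)"
    by simp
  from indep_var_compose[OF this measurable_component_singleton[of 0] measurable_component_singleton[of 1]]
  show ?thesis
    by (simp add: comp_def \<tau>_def)
qed

text \<open>One computation for all three expectations in the covariance: \<open>(f, g)\<close> will
  be \<open>(x, x)\<close>, \<open>(x, 1)\<close> and \<open>(x^2, x)\<close>. The factorization in
  \<open>YAE\<close> is asked for only where \<open>N s \<le> N t\<close>, since the paths are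
  monotone only almost surely.\<close>

lemma poisson_random_product:
  fixes X :: "nat \<Rightarrow> 'a \<Rightarrow> real" and f g :: "real \<Rightarrow> real"
  assumes iid: "iid_sequence X"
    and P: "poisson_process rate N" and rate: "rate > 0"
    and ind: "indep_set (generated_events {0<..} (count_space UNIV) N) (generated_events {1..} borel X)"
    and st: "0 < s" "s < t"
    and [measurable]: "f \<in> borel_measurable borel" "g \<in> borel_measurable borel"
    and fi: "integrable M (\<lambda>\<omega>. f (X 0 \<omega>))" and gi: "integrable M (\<lambda>\<omega>. g (X 0 \<omega>))"
    and Y[measurable]: "random_variable borel Y"
    and YAE: "AE \<omega> in M. N s \<omega> \<le> N t \<omega> \<longrightarrow>
      Y \<omega> = (\<Prod>j=1..N s \<omega>. f (X j \<omega>)) * (\<Prod>j=N s \<omega>+1..N t \<omega>. g (X j \<omega>))"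
  shows "integrable M Y"
    and "expectation Y = exp (rate * s * (expectation (\<lambda>\<omega>. f (X 0 \<omega>)) - 1))
      * exp (rate * (t - s) * (expectation (\<lambda>\<omega>. g (X 0 \<omega>)) - 1))"
proof -
  have N[measurable]: "random_variable (count_space UNIV) (N u)" if "u \<ge> 0" for u
    using P that unfolding poisson_process_def by blast
  have [measurable]: "random_variable (count_space UNIV) (N s)" "random_variable (count_space UNIV) (N t)"
    "random_variable (count_space UNIV) (N 0)"
    using st by (auto intro: N)
  have D: "distr M (count_space UNIV) (\<lambda>\<omega>. N v \<omega> - N u \<omega>) = measure_pmf (poisson_pmf (rate * (v - u)))"
    if "0 \<le> u" "u < v" for u v
    using P that unfolding poisson_process_def by blast
  have N0: "AE \<omega> in M. N 0 \<omega> = 0"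
    using P unfolding poisson_process_def by blast
  have mono: "AE \<omega> in M. N s \<omega> \<le> N t \<omega>"
  proof -
    have "AE \<omega> in M. mono_on {0..} (\<lambda>t. N t \<omega>) \<and> (\<forall>t\<ge>0. continuous (at_right t) (\<lambda>u. N u \<omega>))"
      using P unfolding poisson_process_def by blast
    then show ?thesis
      by eventually_elim (use st in \<open>auto simp: mono_on_def\<close>)
  qed
  \<comment> \<open>The first count is \<open>N s\<close> and not \<open>N s - N 0\<close>:
    independence from the factors is given only for the counts at positive times. Likewise
    \<open>W\<close> starts at index \<open>1\<close>, and \<open>X 0\<close> enters only through
    its law.\<close>
  define Z where "Z \<omega> = (N s \<omega>, N t \<omega> - N s \<omega>)" for \<omega>
  define W where "W \<omega> = (\<lambda>j\<in>{1..}. X j \<omega>)" for \<omega>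
  define h where "h c w = (\<Prod>j=1..fst c. f (w j)) * (\<Prod>j=fst c+1..fst c + snd c. g (w j))"
    for c :: "nat \<times> nat" and w :: "nat \<Rightarrow> real"
  let ?F = "sigma (space M) (\<Union>i\<in>{0<..}. {N i -` A \<inter> space M | A. A \<in> sets (count_space UNIV)})"
  let ?G = "sigma (space M) (\<Union>i\<in>{1..}. {X i -` A \<inter> space M | A. A \<in> sets borel})"
  have [measurable]: "N s \<in> measurable ?F (count_space UNIV)" "N t \<in> measurable ?F (count_space UNIV)"
    using st by (intro measurable_generated; simp)+
  have Zm: "Z \<in> measurable ?F (count_space UNIV)"
    unfolding Z_def by measurable
  have Wm: "W \<in> measurable ?G (PiM {1..} (\<lambda>_. borel))"
    unfolding W_def by (intro measurable_restrict measurable_generated) auto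
  note ZW = distr_pair_of_generated[OF ind Zm Wm]
  have hm: "h c \<in> borel_measurable (PiM {1..} (\<lambda>_. borel))" for c
    unfolding h_def
    by (intro borel_measurable_times borel_measurable_prod measurable_compose[OF measurable_component_singleton]) auto
  have hW: "h c (W \<omega>) = (\<Prod>j=1..fst c. f (X j \<omega>)) * (\<Prod>j=fst c+1..fst c + snd c. g (X j \<omega>))" for c \<omega>
    unfolding h_def W_def by (intro arg_cong2[where f="(*)"] prod.cong) auto
  have habs: "\<bar>h c (W \<omega>)\<bar> = (\<Prod>j=1..fst c. \<bar>f (X j \<omega>)\<bar>) * (\<Prod>j=fst c+1..fst c + snd c. \<bar>g (X j \<omega>)\<bar>)" for c \<omega>
    unfolding hW by (simp add: abs_mult abs_prod)
  have hi: "integrable M (\<lambda>\<omega>. h c (W \<omega>))" for c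
    unfolding hW by (intro iid_expectation_prod iid fi gi) auto
  have hE: "expectation (\<lambda>\<omega>. h c (W \<omega>))
      = expectation (\<lambda>\<omega>. f (X 0 \<omega>)) ^ fst c * expectation (\<lambda>\<omega>. g (X 0 \<omega>)) ^ snd c" for c
    unfolding hW by (intro iid_expectation_prod iid fi gi) auto
  have hA: "expectation (\<lambda>\<omega>. \<bar>h c (W \<omega>)\<bar>)
      = expectation (\<lambda>\<omega>. \<bar>f (X 0 \<omega>)\<bar>) ^ fst c * expectation (\<lambda>\<omega>. \<bar>g (X 0 \<omega>)\<bar>) ^ snd c" for c
    unfolding habs by (intro iid_expectation_prod(2)[where f="\<lambda>x. \<bar>f x\<bar>" and g="\<lambda>x. \<bar>g x\<bar>"] iid integrable_abs fi gi) auto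
  \<comment> \<open>The joint generating function of the two counts is needed at two points: at the
    means of \<open>\<bar>f\<bar>\<close> and \<open>\<bar>g\<bar>\<close> for integrability, and at
    the means of \<open>f\<close> and \<open>g\<close> for the value.\<close>
  have pgf: "integrable M (\<lambda>\<omega>. c ^ fst (Z \<omega>) * d ^ snd (Z \<omega>))"
    "expectation (\<lambda>\<omega>. c ^ fst (Z \<omega>) * d ^ snd (Z \<omega>)) = exp (rate * s * (c - 1)) * exp (rate * (t - s) * (d - 1))"
    for c d :: real
  proof -
    let ?A = "\<lambda>\<omega>. N s \<omega> - N 0 \<omega>" and ?B = "\<lambda>\<omega>. N t \<omega> - N s \<omega>"
    have A: "integrable M (\<lambda>\<omega>. c ^ ?A \<omega>)" "expectation (\<lambda>\<omega>. c ^ ?A \<omega>) = exp (rate * s * (c - 1))"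
      using expectation_power_poisson[OF _ D[of 0 s], of c] st rate by auto
    have B: "integrable M (\<lambda>\<omega>. d ^ ?B \<omega>)" "expectation (\<lambda>\<omega>. d ^ ?B \<omega>) = exp (rate * (t - s) * (d - 1))"
      using expectation_power_poisson[OF _ D[of s t], of d] st rate by auto
    have i: "indep_var borel (\<lambda>\<omega>. c ^ ?A \<omega>) borel (\<lambda>\<omega>. d ^ ?B \<omega>)"
      using indep_var_compose[OF poisson_process_two_increments[OF P st], of "\<lambda>k. c ^ k" borel "\<lambda>k. d ^ k" borel]
      by (simp add: comp_def)
    \<comment> \<open>The process axioms speak of the increment from \<open>N 0\<close>; it agrees
      with \<open>N s\<close> almost surely.\<close>
    have ae: "AE \<omega> in M. c ^ ?A \<omega> * d ^ ?B \<omega> = c ^ fst (Z \<omega>) * d ^ snd (Z \<omega>)"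
      using N0 by eventually_elim (simp add: Z_def)
    have m: "(\<lambda>\<omega>. c ^ ?A \<omega> * d ^ ?B \<omega>) \<in> borel_measurable M"
      "(\<lambda>\<omega>. c ^ fst (Z \<omega>) * d ^ snd (Z \<omega>)) \<in> borel_measurable M"
      unfolding Z_def by simp_all
    show "integrable M (\<lambda>\<omega>. c ^ fst (Z \<omega>) * d ^ snd (Z \<omega>))"
      using indep_var_integrable[OF i A(1) B(1)] integrable_cong_AE[OF m ae] by simp
    show "expectation (\<lambda>\<omega>. c ^ fst (Z \<omega>) * d ^ snd (Z \<omega>)) = exp (rate * s * (c - 1)) * exp (rate * (t - s) * (d - 1))"
      using indep_var_lebesgue_integral[OF i A(1) B(1)] integral_cong_AE[OF m ae] A(2) B(2) by simp
  qed
  \<comment> \<open>After rewriting with \<open>hA\<close>, the Fubini condition is integrability of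
    a product of powers of absolute means, which is \<open>pgf(1)\<close>; \<open>hE\<close>
    evaluates the inner expectation in the conclusion.\<close>
  note mix = indep_countable_mixture[OF ZW, of h, OF hm hi, unfolded hA hE, OF pgf(1)]
  have ae: "AE \<omega> in M. h (Z \<omega>) (W \<omega>) = Y \<omega>"
    using YAE mono by eventually_elim (simp add: hW Z_def)
  have m: "(\<lambda>\<omega>. h (Z \<omega>) (W \<omega>)) \<in> borel_measurable M"
    using mix(1) by simp
  show "integrable M Y"
    using mix(1) integrable_cong_AE[OF m Y ae] by simp
  show "expectation Y = exp (rate * s * (expectation (\<lambda>\<omega>. f (X 0 \<omega>)) - 1))
      * exp (rate * (t - s) * (expectation (\<lambda>\<omega>. g (X 0 \<omega>)) - 1))"
    using mix(2) integral_cong_AE[OF m Y ae] pgf(2) by simp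
qed

section \<open>Measurability, the covariance formula and the exponential integral\<close>

text \<open>The number of factors is random but has countably many values, so the products of fixed
  length are glued along them.\<close>

lemma poisson_product_measurable:
  assumes [measurable]: "\<And>j. random_variable borel (X j)" "random_variable (count_space UNIV) (N t)"
  shows "random_variable borel (poisson_product X N t)"
  unfolding poisson_product_def[abs_def]
  by (rule measurable_compose_countable[where f="\<lambda>n \<omega>. \<Prod>j = 1..n. X j \<omega>"]) auto

lemma covariance_eq:
  assumes "integrable M Y" "integrable M Z" "integrable M (\<lambda>\<omega>. Y \<omega> * Z \<omega>)"
  shows "covariance Y Z = expectation (\<lambda>\<omega>. Y \<omega> * Z \<omega>) - expectation Y * expectation Z"
proof -
  have "covariance Y Z = expectation (\<lambda>\<omega>. Y \<omega> * Z \<omega> - expectation Z * Y \<omega> - expectation Y * Z \<omega>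
      + expectation Y * expectation Z)"
    unfolding covariance_def by (simp add: algebra_simps)
  also have "\<dots> = expectation (\<lambda>\<omega>. Y \<omega> * Z \<omega>) - expectation Y * expectation Z"
    using assms by (simp add: prob_space)
  finally show ?thesis .
qed

end

text \<open>The antiderivative is \<open>exp (r * w)\<close>. The integral is oriented, so either
  order of the end points is covered.\<close>

lemma interval_integral_exp:
  fixes a b r :: real
  shows "(LBINT w=a..b. r * exp (r * w)) = exp (r * b) - exp (r * a)"
proof (rule interval_integral_FTC_finite)
  show "continuous_on {min a b..max a b} (\<lambda>w. r * exp (r * w))"
    by (intro continuous_intros)
  show "((\<lambda>w. exp (r * w)) has_vector_derivative r * exp (r * x)) (at x within {min a b..max a b})" for x
    by (auto intro!: derivative_eq_intros simp flip: has_real_derivative_iff_has_vector_derivative)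
qed

section \<open>The covariance of the Poisson product at two times\<close>

theorem theorem4p1:
  fixes M :: "'a measure"
    and X :: "nat \<Rightarrow> 'a \<Rightarrow> real"  (* X 0 is the generic X of the family X, X_1, X_2, ... *)
    and N :: "real \<Rightarrow> 'a \<Rightarrow> nat"
    and rate s t :: real
  assumes "prob_space M"
    and "prob_space.iid_sequence M X"
    and "integrable M (\<lambda>\<omega>. (X 0 \<omega>)\<^sup>2)"
    and "rate > 0"
    and "prob_space.poisson_process M rate N"
    and "prob_space.indep_set M
           (prob_space.generated_events M {0<..} (count_space UNIV) N)
           (prob_space.generated_events M {1..} borel X)"
    and "0 < s" and "s < t"
  shows
    (* the covariance is well defined *)
    "integrable M (poisson_product X N t) \<and>
     integrable M (poisson_product X N s) \<and>
     integrable M (\<lambda>\<omega>. poisson_product X N t \<omega> * poisson_product X N s \<omega>) \<and>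
     prob_space.covariance M (poisson_product X N t) (poisson_product X N s) =
       exp (rate * t * ((LINT \<omega>|M. X 0 \<omega>) - 1)) *
       (exp (rate * s * (LINT \<omega>|M. X 0 \<omega> * (X 0 \<omega> - 1))) -
        exp (rate * s * ((LINT \<omega>|M. X 0 \<omega>) - 1))) \<and>
     exp (rate * t * ((LINT \<omega>|M. X 0 \<omega>) - 1)) *
       (exp (rate * s * (LINT \<omega>|M. X 0 \<omega> * (X 0 \<omega> - 1))) -
        exp (rate * s * ((LINT \<omega>|M. X 0 \<omega>) - 1))) =
     exp (rate * t * ((LINT \<omega>|M. X 0 \<omega>) - 1)) *
       (LBINT w = s * (LINT \<omega>|M. X 0 \<omega> - 1)..s * (LINT \<omega>|M. X 0 \<omega> * (X 0 \<omega> - 1)).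
          rate * exp (rate * w))"
proof -
  interpret prob_space M by fact
  note iid = assms(2) and P = assms(5) and ind = assms(6)
  have X[measurable]: "random_variable borel (X j)" for j
    using iid unfolding iid_sequence_def indep_vars_def by auto
  have [measurable]: "random_variable (count_space UNIV) (N s)" "random_variable (count_space UNIV) (N t)"
    using P assms(7,8) unfolding poisson_process_def by auto
  have [measurable]: "random_variable borel (poisson_product X N s)"
    "random_variable borel (poisson_product X N t)"
    by (rule poisson_product_measurable; simp)+
  note sq = assms(3)
  have i1: "integrable M (X 0)"
    using square_integrable_imp_integrable[OF X sq] .
  \<comment> \<open>If \<open>N t < N s\<close>, the tail is an empty product and the identity can
    fail; hence the restriction.\<close>
  have split: "poisson_product X N t \<omega> = poisson_product X N s \<omega> * (\<Prod>j=N s \<omega>+1..N t \<omega>. X j \<omega>)"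
    if "N s \<omega> \<le> N t \<omega>" for \<omega>
    using prod.ub_add_nat[of 1 "N s \<omega>" "\<lambda>j. X j \<omega>" "N t \<omega> - N s \<omega>"] that
    by (simp add: poisson_product_def)
  note rp = poisson_random_product[OF iid P assms(4) ind assms(7,8)]
  define m where "m = (LINT \<omega>|M. X 0 \<omega>)"
  define m2 where "m2 = (LINT \<omega>|M. (X 0 \<omega>)\<^sup>2)"
  have t: "integrable M (poisson_product X N t)"
    "expectation (poisson_product X N t) = exp (rate * s * (m - 1)) * exp (rate * (t - s) * (m - 1))"
    unfolding m_def by (rule rp[of "\<lambda>x. x" "\<lambda>x. x"]; use i1 split in \<open>simp add: poisson_product_def\<close>)+
  have s: "integrable M (poisson_product X N s)"
    "expectation (poisson_product X N s) = exp (rate * s * (m - 1))"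
  proof -
    \<comment> \<open>Choosing \<open>g = 1\<close> pads the product up to \<open>N t\<close>; its
      mean is \<open>1\<close>, so the second exponential becomes \<open>exp 0\<close>.\<close>
    have ae: "AE \<omega> in M. N s \<omega> \<le> N t \<omega> \<longrightarrow>
        poisson_product X N s \<omega> = (\<Prod>j=1..N s \<omega>. X j \<omega>) * (\<Prod>j=N s \<omega>+1..N t \<omega>. 1)"
      by (simp add: poisson_product_def)
    show "integrable M (poisson_product X N s)"
      by (rule rp(1)[OF _ _ i1 _ _ ae]) simp_all
    have "expectation (poisson_product X N s)
        = exp (rate * s * (m - 1)) * exp (rate * (t - s) * (expectation (\<lambda>\<omega>. 1) - 1))"
      unfolding m_def by (rule rp(2)[OF _ _ i1 _ _ ae]) simp_all
    then show "expectation (poisson_product X N s) = exp (rate * s * (m - 1))"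
      by (simp add: prob_space)
  qed
  have ts: "integrable M (\<lambda>\<omega>. poisson_product X N t \<omega> * poisson_product X N s \<omega>)"
    "expectation (\<lambda>\<omega>. poisson_product X N t \<omega> * poisson_product X N s \<omega>)
      = exp (rate * s * (m2 - 1)) * exp (rate * (t - s) * (m - 1))"
  proof -
    \<comment> \<open>Factors up to \<open>N s\<close> occur in both products and are squared, which
      is where the second moment enters; later ones occur once.\<close>
    have "poisson_product X N t \<omega> * poisson_product X N s \<omega>
        = (\<Prod>j=1..N s \<omega>. (X j \<omega>)\<^sup>2) * (\<Prod>j=N s \<omega>+1..N t \<omega>. X j \<omega>)" if "N s \<omega> \<le> N t \<omega>" for \<omega>
      unfolding split[OF that] by (simp add: poisson_product_def power2_eq_square prod.distrib)
    then have ae: "AE \<omega> in M. N s \<omega> \<le> N t \<omega> \<longrightarrow> poisson_product X N t \<omega> * poisson_product X N s \<omega>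
        = (\<Prod>j=1..N s \<omega>. (X j \<omega>)\<^sup>2) * (\<Prod>j=N s \<omega>+1..N t \<omega>. X j \<omega>)"
      by simp
    show "integrable M (\<lambda>\<omega>. poisson_product X N t \<omega> * poisson_product X N s \<omega>)"
      by (rule rp(1)[OF _ _ sq i1 _ ae]) simp_all
    show "expectation (\<lambda>\<omega>. poisson_product X N t \<omega> * poisson_product X N s \<omega>)
        = exp (rate * s * (m2 - 1)) * exp (rate * (t - s) * (m - 1))"
      unfolding m_def m2_def by (rule rp(2)[OF _ _ sq i1 _ ae]) simp_all
  qed
  have e2: "(LINT \<omega>|M. X 0 \<omega> * (X 0 \<omega> - 1)) = m2 - m"
    using i1 sq by (simp add: m_def m2_def algebra_simps power2_eq_square)
  have e1: "(LINT \<omega>|M. X 0 \<omega> - 1) = m - 1"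
    using i1 by (simp add: m_def prob_space)
  have cov: "covariance (poisson_product X N t) (poisson_product X N s)
      = exp (rate * t * (m - 1)) * (exp (rate * s * (m2 - m)) - exp (rate * s * (m - 1)))"
  proof -
    \<comment> \<open>Regrouping the exponents,
      \<open>s (m2 - 1) + (t - s) (m - 1) = t (m - 1) + s (m2 - m)\<close>, exposes the factor
      common to the mixed moment and the product of the means.\<close>
    have "exp (rate * s * (m2 - 1)) * exp (rate * (t - s) * (m - 1))
        = exp (rate * t * (m - 1)) * exp (rate * s * (m2 - m))"
      unfolding exp_add[symmetric] by (rule arg_cong[where f=exp]) (simp add: algebra_simps)
    moreover have "exp (rate * s * (m - 1)) * exp (rate * (t - s) * (m - 1)) = exp (rate * t * (m - 1))"
      unfolding exp_add[symmetric] by (rule arg_cong[where f=exp]) (simp add: algebra_simps)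
    ultimately show ?thesis
      unfolding covariance_eq[OF t(1) s(1) ts(1)] t(2) s(2) ts(2) by (simp only: right_diff_distrib)
  qed
  have int: "(LBINT w = s * (m - 1)..s * (m2 - m). rate * exp (rate * w))
      = exp (rate * s * (m2 - m)) - exp (rate * s * (m - 1))"
    using interval_integral_exp[of "s * (m - 1)" "s * (m2 - m)" rate] by (simp add: mult_ac)
  show ?thesis
    unfolding e1 e2 m_def[symmetric] using t(1) s(1) ts(1) cov int by simp
qed

end
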